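(* Let $\beta>0$ and let $X\sim P$ be a random variable in $\mathcal H$ with $\mathbb{E}[\|X\|^q]<\infty$ for an integer $q\ge2$, and suppose that $\rho_1(1/3)\ge\mathbb{E}[\rho_1(\|X-\mathbb{E}[X]\|/\beta)]$. Then $$\|\mathbb{E}[X]-T_H(P)\|\le\frac{2\,\mathbb{E}[\|X-\mathbb{E}[X]\|^q]}{(q-1)\beta^{q-1}}.$$
   Context: $\mathcal H$ is a real Hilbert space with norm $\|\cdot\|$ coming from its scalar product. Huber's score: $\psi_H(x)=x\mathbf{1}\{x\le\beta\}+\beta\mathbf{1}\{x>\beta\}$ for $x\ge0$; write $\psi_H(x)=\beta\psi_1(x/\beta)$, i.e. $\psi_1(x)=\min(x,1)$, and $\rho_1(x)=\int_0^x\psi_1(t)\,dt$. $T_H(P)$ is the (unique) solution of $\mathbb{E}\left[\frac{X-T_H(P)}{\|X-T_H(P)\|}\psi_H(\|X-T_H(P)\|)\right]=0$ (the integrand is $0$ when $X=T_H(P)$), equivalently the minimizer of $\theta\mapsto\mathbb{E}[\rho_1(\|X-\theta\|/\beta)]$. *)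

theory Defs
  imports "HOL-Probability.Probability"
begin

text \<open>
  A strongly measurable random variable: Borel, with almost surely separable range. When the space
  is separable the second conjunct always holds, and this is plain Borel measurability.
\<close>

definition random_element :: "'a measure \<Rightarrow> ('a \<Rightarrow> 'h::metric_space) \<Rightarrow> bool" where
  "random_element M X \<longleftrightarrow>
     X \<in> borel_measurable M \<and> (\<exists>D. countable D \<and> (AE \<omega> in M. X \<omega> \<in> closure D))"

lemma random_element_separable:
  fixes X :: "'a \<Rightarrow> 'h::{metric_space, second_countable_topology}"
  shows "random_element M X \<longleftrightarrow> X \<in> borel_measurable M"
proof -
  obtain D :: "'h set" where "countable D" and D: "\<And>U. open U \<Longrightarrow> U \<noteq> {} \<Longrightarrow> \<exists>d\<in>D. d \<in> U"
    using countable_dense_setE by blast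
  moreover have "closure D = UNIV"
    using D[of "- closure D"] closure_subset[of D] by auto
  ultimately show ?thesis
    unfolding random_element_def by (metis UNIV_I AE_I2)
qed

text \<open>
  The library's Bochner integral carries the sort constraint \<open>second_countable_topology\<close>, which
  would exclude non-separable Hilbert spaces. The predicate below repeats the definition of
  \<open>has_bochner_integral\<close> without that constraint.
\<close>

definition has_bochner_expectation :: "'a measure \<Rightarrow> ('a \<Rightarrow> 'h::real_normed_vector) \<Rightarrow> 'h \<Rightarrow> bool" where
  "has_bochner_expectation M f x \<longleftrightarrow>
     f \<in> borel_measurable M \<and>
     (\<exists>s. (\<forall>i. Bochner_Integration.simple_bochner_integrable M (s i)) \<and>
          (\<lambda>i::nat. \<integral>\<^sup>+\<omega>. ennreal (norm (f \<omega> - s i \<omega>)) \<partial>M) \<longlonglongrightarrow> 0 \<and>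
          (\<lambda>i. Bochner_Integration.simple_bochner_integral M (s i)) \<longlonglongrightarrow> x)"

definition bochner_expectation :: "'a measure \<Rightarrow> ('a \<Rightarrow> 'h::real_normed_vector) \<Rightarrow> 'h" where
  "bochner_expectation M f = (THE x. has_bochner_expectation M f x)"

lemma has_bochner_expectation_iff_has_bochner_integral:
  fixes f :: "'a \<Rightarrow> 'h::{real_normed_vector, second_countable_topology}"
  shows "has_bochner_expectation M f x \<longleftrightarrow> has_bochner_integral M f x"
  unfolding has_bochner_expectation_def has_bochner_integral.simps by auto

lemma bochner_expectation_eq_integral:
  fixes f :: "'a \<Rightarrow> 'h::{real_normed_vector, second_countable_topology}"
  assumes "integrable M f"
  shows "bochner_expectation M f = integral\<^sup>L M f"
  unfolding bochner_expectation_def has_bochner_expectation_iff_has_bochner_integral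
  using has_bochner_integral_integrable[OF assms] has_bochner_integral_eq by blast

definition psi_H :: "real \<Rightarrow> real \<Rightarrow> real" where
  "psi_H \<beta> x = x * indicator {..\<beta>} x + \<beta> * indicator {\<beta><..} x"

definition psi_1 :: "real \<Rightarrow> real" where
  "psi_1 x = min x 1"

lemma psi_H_eq_psi_1: "\<beta> > 0 \<Longrightarrow> psi_H \<beta> x = \<beta> * psi_1 (x / \<beta>)"
  by (auto simp: psi_H_def psi_1_def min_def field_simps)

text \<open>Only used at arguments \<open>x \<ge> 0\<close>.\<close>

definition rho_1 :: "real \<Rightarrow> real" where
  "rho_1 x = integral {0..x} psi_1"

text \<open>
  The integrand is \<open>0\<close> at \<open>x = \<theta>\<close>, since \<open>0 /\<^sub>R 0 = 0\<close>.
\<close>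

definition is_huber_location :: "real \<Rightarrow> 'h::real_normed_vector measure \<Rightarrow> 'h \<Rightarrow> bool" where
  "is_huber_location \<beta> P \<theta> \<longleftrightarrow>
     has_bochner_expectation P
       (\<lambda>x. psi_H \<beta> (norm (x - \<theta>)) *\<^sub>R ((x - \<theta>) /\<^sub>R norm (x - \<theta>))) 0"

definition T_H :: "real \<Rightarrow> 'h::real_normed_vector measure \<Rightarrow> 'h" where
  "T_H \<beta> P = (THE \<theta>. is_huber_location \<beta> P \<theta>)"

end

theory Submission
  imports Defs
begin

text \<open>
  Write \<open>m\<close> for the mean and split \<open>x - \<theta>\<close> into its projection \<open>clip\<close> onto the ball of radius \<open>\<beta>\<close>, which
  is the Huber score, and the remainder \<open>excess\<close>. Then \<open>\<theta>\<close> is a Huber location iff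
  \<open>\<theta> = m - S \<theta>\<close>, where \<open>S \<theta>\<close> is the expectation of \<open>excess \<beta> (x - \<theta>)\<close>. Since \<open>excess\<close> is nonexpansive
  and vanishes on the ball, the smallness hypothesis makes \<open>S\<close> a \<open>1 / 4\<close>-contraction near \<open>m\<close>, with
  \<open>norm (S m) \<le> \<beta> / 18\<close>. Banach's fixed point theorem gives a solution \<open>\<theta>\<close>, unique even globally, and
  \<open>norm (m - \<theta>) \<le> 4 / 3 * norm (S m)\<close>. Finally \<open>norm (S m)\<close> is at most the mean of
  \<open>max 0 (norm (x - m) - \<beta>)\<close>, which Bernoulli's inequality bounds by the \<open>q\<close>-th moment.
\<close>

section \<open>The Bochner expectation in a nonseparable space\<close>

text \<open>In a nonseparable space the difference of two Borel maps may fail to be Borel. Since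
  \<open>s\<close> takes only finitely many values, measurability can be checked separately on each
  of its level sets, where a constant is subtracted.\<close>

lemma borel_measurable_norm_diff_simple_function:
  fixes f :: "'a \<Rightarrow> 'h::real_normed_vector"
  assumes f: "f \<in> borel_measurable M" and s: "simple_function M s"
  shows "(\<lambda>\<omega>. norm (f \<omega> - s \<omega>)) \<in> borel_measurable M"
proof (rule measurable_compose_countable'[where I = "s ` space M" and g = s])
  show "(\<lambda>\<omega>. norm (f \<omega> - c)) \<in> borel_measurable M" for c
    by (rule borel_measurable_continuous_on[OF _ f]) (intro continuous_intros)
  show "s \<in> measurable M (count_space (s ` space M))"
    using s by (auto simp: simple_function_def measurable_count_space_eq2)
  show "countable (s ` space M)"
    using s by (simp add: simple_function_def countable_finite)
qed

text \<open>The triangle inequality through \<open>f\<close> bounds the integral of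
  \<open>norm (s \<omega> - t \<omega>)\<close>. This is the Cauchy estimate for the integrals of
  simple functions approximating \<open>f\<close>.\<close>

lemma norm_simple_bochner_integral_diff_le:
  fixes f :: "'a \<Rightarrow> 'h::real_normed_vector"
  assumes f: "f \<in> borel_measurable M"
    and s: "Bochner_Integration.simple_bochner_integrable M s"
    and t: "Bochner_Integration.simple_bochner_integrable M t"
  shows "ennreal (norm (Bochner_Integration.simple_bochner_integral M s
      - Bochner_Integration.simple_bochner_integral M t)) \<le>
    (\<integral>\<^sup>+\<omega>. norm (f \<omega> - s \<omega>) \<partial>M) + (\<integral>\<^sup>+\<omega>. norm (f \<omega> - t \<omega>) \<partial>M)"
proof -
  have meas: "(\<lambda>\<omega>. norm (f \<omega> - s \<omega>)) \<in> borel_measurable M"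
      "(\<lambda>\<omega>. norm (f \<omega> - t \<omega>)) \<in> borel_measurable M"
    using s t f
    by (auto intro!: borel_measurable_norm_diff_simple_function
      elim: Bochner_Integration.simple_bochner_integrable.cases)
  have st: "Bochner_Integration.simple_bochner_integrable M (\<lambda>\<omega>. s \<omega> - t \<omega>)"
    and nst: "Bochner_Integration.simple_bochner_integrable M (\<lambda>\<omega>. norm (s \<omega> - t \<omega>))"
    using s t by (auto intro: Bochner_Integration.simple_bochner_integrable_compose2)
  have "ennreal (norm (Bochner_Integration.simple_bochner_integral M s
        - Bochner_Integration.simple_bochner_integral M t))
      \<le> ennreal (Bochner_Integration.simple_bochner_integral M (\<lambda>\<omega>. norm (s \<omega> - t \<omega>)))"
    using Bochner_Integration.simple_bochner_integral_norm_bound[OF st]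
      Bochner_Integration.simple_bochner_integral_diff[OF s t]
    by (simp add: ennreal_leI)
  also have "\<dots> = (\<integral>\<^sup>+\<omega>. norm (s \<omega> - t \<omega>) \<partial>M)"
    by (rule Bochner_Integration.simple_bochner_integral_eq_nn_integral[OF nst]) simp
  also have "\<dots> \<le> (\<integral>\<^sup>+\<omega>. ennreal (norm (f \<omega> - s \<omega>)) + ennreal (norm (f \<omega> - t \<omega>)) \<partial>M)"
  proof (rule nn_integral_mono)
    fix \<omega>
    have "norm (s \<omega> - t \<omega>) \<le> norm (f \<omega> - s \<omega>) + norm (f \<omega> - t \<omega>)"
      by (metis norm_diff_triangle_le norm_minus_commute order_refl)
    then show "ennreal (norm (s \<omega> - t \<omega>)) \<le> ennreal (norm (f \<omega> - s \<omega>)) + ennreal (norm (f \<omega> - t \<omega>))"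
      by (simp flip: ennreal_plus)
  qed
  also have "\<dots> = (\<integral>\<^sup>+\<omega>. norm (f \<omega> - s \<omega>) \<partial>M) + (\<integral>\<^sup>+\<omega>. norm (f \<omega> - t \<omega>) \<partial>M)"
    using meas by (intro nn_integral_add) auto
  finally show ?thesis .
qed

text \<open>A point closest to \<open>x\<close> among 0 and the first \<open>n\<close> terms of
  \<open>e\<close>, ties keeping the earlier choice. Starting from 0 bounds the error by
  \<open>norm x\<close>, which later serves as the dominating function.\<close>

primrec nearest :: "(nat \<Rightarrow> 'h::real_normed_vector) \<Rightarrow> nat \<Rightarrow> 'h \<Rightarrow> 'h" where
  "nearest e 0 x = 0"
| "nearest e (Suc n) x = (if norm (x - e n) < norm (x - nearest e n x) then e n else nearest e n x)"

lemma norm_diff_nearest_le_norm: "norm (x - nearest e n x) \<le> norm x"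
  by (induction n) auto

lemma norm_diff_nearest_le: "k < n \<Longrightarrow> norm (x - nearest e n x) \<le> norm (x - e k)"
  by (induction n) (auto simp: less_Suc_eq)

lemma simple_function_nearest:
  assumes f: "f \<in> borel_measurable M"
  shows "simple_function M (\<lambda>\<omega>. nearest e n (f \<omega>))"
proof (induction n)
  case (Suc n)
  have [measurable]: "(\<lambda>\<omega>. norm (f \<omega> - nearest e n (f \<omega>))) \<in> borel_measurable M"
    by (rule borel_measurable_norm_diff_simple_function[OF f Suc])
  have [measurable]: "(\<lambda>\<omega>. norm (f \<omega> - e n)) \<in> borel_measurable M"
    by (rule borel_measurable_norm_diff_simple_function[OF f]) simp
  have "{\<omega>\<in>space M. norm (f \<omega> - e n) < norm (f \<omega> - nearest e n (f \<omega>))} \<in> sets M"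
    by measurable
  then show ?case
    unfolding nearest.simps by (intro simple_function_If Suc) auto
qed simp

text \<open>Nearest points in a countable set whose closure almost surely contains the values of
  \<open>f\<close> give simple functions. Dominated convergence sends their error to 0 in mean, so
  their integrals form a Cauchy sequence and completeness supplies the limit.\<close>

theorem has_bochner_expectation_exists:
  fixes f :: "'a \<Rightarrow> 'h::{real_normed_vector, complete_space}"
  assumes f: "random_element M f" and int: "integrable M (\<lambda>\<omega>. norm (f \<omega>))"
  shows "\<exists>x. has_bochner_expectation M f x"
proof -
  obtain D where fm: "f \<in> borel_measurable M" and D: "countable D" "AE \<omega> in M. f \<omega> \<in> closure D"
    using f unfolding random_element_def by blast
  \<comment> \<open>Inserting 0 makes the set nonempty, so that \<open>from_nat_into\<close> really
    enumerates it.\<close>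
  define e where "e = from_nat_into (insert 0 D)"
  have range_e: "range e = insert 0 D"
    unfolding e_def using D(1) by (intro range_from_nat_into) auto
  define s where "s i \<omega> = nearest e i (f \<omega>)" for i \<omega>
  have simp_s: "simple_function M (s i)" for i
    unfolding s_def by (rule simple_function_nearest[OF fm])
  have fin: "(\<integral>\<^sup>+\<omega>. norm (f \<omega>) \<partial>M) < \<infinity>"
    using int by (simp add: integrable_iff_bounded)
  have meas: "(\<lambda>\<omega>. norm (f \<omega>)) \<in> borel_measurable M"
    using int by simp
  have conv: "(\<lambda>i. norm (x - nearest e i x)) \<longlonglongrightarrow> 0" if x: "x \<in> closure D" for x
  proof (rule LIMSEQ_I)
    fix r :: real assume "r > 0"
    then obtain d where "d \<in> D" "dist d x < r"
      using x unfolding closure_approachable by blast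
    then obtain k where "norm (x - e k) < r"
      using range_e by (metis dist_norm imageE insertCI norm_minus_commute)
    then show "\<exists>no. \<forall>n\<ge>no. norm (norm (x - nearest e n x) - 0) < r"
      \<comment> \<open>\<open>nearest e n\<close> only sees the terms of index below
        \<open>n\<close>, hence \<open>Suc k\<close> rather than \<open>k\<close>.\<close>
      by (intro exI[of _ "Suc k"]) (auto simp: Suc_le_eq intro: le_less_trans[OF norm_diff_nearest_le])
  qed
  have lim: "(\<lambda>i. \<integral>\<^sup>+\<omega>. ennreal (norm (f \<omega> - s i \<omega>)) \<partial>M) \<longlonglongrightarrow> (\<integral>\<^sup>+\<omega>. 0 \<partial>M)"
  proof (rule nn_integral_dominated_convergence[where w = "\<lambda>\<omega>. norm (f \<omega>)"])
    show "(\<lambda>\<omega>. ennreal (norm (f \<omega> - s i \<omega>))) \<in> borel_measurable M" for i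
      using borel_measurable_norm_diff_simple_function[OF fm simp_s] by simp
    show "AE \<omega> in M. (\<lambda>i. ennreal (norm (f \<omega> - s i \<omega>))) \<longlonglongrightarrow> 0"
      using D(2) by eventually_elim (auto simp: s_def intro: conv simp flip: ennreal_0)
    show "AE \<omega> in M. ennreal (norm (f \<omega> - s i \<omega>)) \<le> ennreal (norm (f \<omega>))" for i
      by (auto simp: s_def intro!: ennreal_leI norm_diff_nearest_le_norm)
  qed (use meas fin in auto)
  have sbi: "Bochner_Integration.simple_bochner_integrable M (s i)" for i
  proof (rule Bochner_Integration.simple_bochner_integrableI_bounded[OF simp_s])
    have "norm (s i \<omega>) \<le> 2 * norm (f \<omega>)" for \<omega>
      using norm_diff_nearest_le_norm[of "f \<omega>" e i] norm_triangle_ineq4[of "f \<omega>" "f \<omega> - s i \<omega>"]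
      by (simp add: s_def)
    then have "(\<integral>\<^sup>+\<omega>. norm (s i \<omega>) \<partial>M) \<le> (\<integral>\<^sup>+\<omega>. 2 * ennreal (norm (f \<omega>)) \<partial>M)"
      by (intro nn_integral_mono) (metis ennreal_leI ennreal_mult' ennreal_numeral zero_le_numeral)
    also have "\<dots> < \<infinity>"
      using fin meas by (simp add: nn_integral_cmult ennreal_mult_less_top)
    finally show "(\<integral>\<^sup>+\<omega>. norm (s i \<omega>) \<partial>M) < \<infinity>" .
  qed
  define I where "I i = Bochner_Integration.simple_bochner_integral M (s i)" for i
  have "Cauchy I"
  proof (rule metric_CauchyI)
    fix r :: real assume "r > 0"
    then have "\<forall>\<^sub>F i in sequentially. (\<integral>\<^sup>+\<omega>. ennreal (norm (f \<omega> - s i \<omega>)) \<partial>M) < ennreal (r / 2)"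
      using lim by (intro order_tendstoD) auto
    then obtain N where N: "\<And>i. i \<ge> N \<Longrightarrow> (\<integral>\<^sup>+\<omega>. ennreal (norm (f \<omega> - s i \<omega>)) \<partial>M) < ennreal (r / 2)"
      unfolding eventually_sequentially by blast
    show "\<exists>N. \<forall>m\<ge>N. \<forall>n\<ge>N. dist (I m) (I n) < r"
    proof (intro exI[of _ N] allI impI)
      fix m n assume "m \<ge> N" "n \<ge> N"
      have "ennreal (dist (I m) (I n))
          \<le> (\<integral>\<^sup>+\<omega>. norm (f \<omega> - s m \<omega>) \<partial>M) + (\<integral>\<^sup>+\<omega>. norm (f \<omega> - s n \<omega>) \<partial>M)"
        unfolding dist_norm I_def by (rule norm_simple_bochner_integral_diff_le[OF fm sbi sbi])
      also have "\<dots> < ennreal (r / 2) + ennreal (r / 2)"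
        using N \<open>m \<ge> N\<close> \<open>n \<ge> N\<close> by (intro add_strict_mono) auto
      also have "\<dots> = ennreal r"
        using \<open>r > 0\<close> by (simp flip: ennreal_plus)
      finally show "dist (I m) (I n) < r"
        using \<open>r > 0\<close> by (simp add: ennreal_less_iff)
    qed
  qed
  then obtain x where "I \<longlonglongrightarrow> x"
    using Cauchy_convergent convergent_def by blast
  with fm sbi lim show ?thesis
    unfolding has_bochner_expectation_def I_def by auto
qed

section \<open>Inner products, uniqueness and norm bounds for expectations\<close>

lemma has_bochner_expectation_inner:
  fixes f :: "'a \<Rightarrow> 'h::real_inner"
  assumes "has_bochner_expectation M f x"
  shows "has_bochner_integral M (\<lambda>\<omega>. f \<omega> \<bullet> y) (x \<bullet> y)"
proof -
  obtain s where fm: "f \<in> borel_measurable M" and s: "\<And>i. Bochner_Integration.simple_bochner_integrable M (s i)"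
    and lim: "(\<lambda>i::nat. \<integral>\<^sup>+\<omega>. ennreal (norm (f \<omega> - s i \<omega>)) \<partial>M) \<longlonglongrightarrow> 0"
    and x: "(\<lambda>i. Bochner_Integration.simple_bochner_integral M (s i)) \<longlonglongrightarrow> x"
    using assms unfolding has_bochner_expectation_def by blast
  \<comment> \<open>Against a vector of norm at most 1, Cauchy-Schwarz carries the approximation
    error over without a constant. The factor \<open>norm y\<close> is restored at the end, and
    \<open>sgn 0 = 0\<close> covers \<open>y = 0\<close>.\<close>
  define u where "u = sgn y"
  have u: "norm u \<le> 1"
    by (simp add: u_def norm_sgn)
  have "has_bochner_integral M (\<lambda>\<omega>. f \<omega> \<bullet> u) (x \<bullet> u)"
  proof (rule has_bochner_integral.intros)
    show "(\<lambda>\<omega>. f \<omega> \<bullet> u) \<in> borel_measurable M"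
      by (rule borel_measurable_continuous_on[OF _ fm]) (intro continuous_intros)
    show "Bochner_Integration.simple_bochner_integrable M (\<lambda>\<omega>. s i \<omega> \<bullet> u)" for i
      using Bochner_Integration.simple_bochner_integrable_compose2[OF _ s s, of "\<lambda>a _. a \<bullet> u"] by simp
    have le: "(\<integral>\<^sup>+\<omega>. norm (f \<omega> \<bullet> u - s i \<omega> \<bullet> u) \<partial>M) \<le> (\<integral>\<^sup>+\<omega>. norm (f \<omega> - s i \<omega>) \<partial>M)" for i
    proof (intro nn_integral_mono ennreal_leI)
      fix \<omega>
      have "norm (f \<omega> \<bullet> u - s i \<omega> \<bullet> u) \<le> norm (f \<omega> - s i \<omega>) * norm u"
        using Cauchy_Schwarz_ineq2[of "f \<omega> - s i \<omega>" u] by (simp add: inner_diff_left)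
      also have "\<dots> \<le> norm (f \<omega> - s i \<omega>)"
        using u by (simp add: mult_left_le)
      finally show "norm (f \<omega> \<bullet> u - s i \<omega> \<bullet> u) \<le> norm (f \<omega> - s i \<omega>)" .
    qed
    show "(\<lambda>i. \<integral>\<^sup>+\<omega>. norm (f \<omega> \<bullet> u - s i \<omega> \<bullet> u) \<partial>M) \<longlonglongrightarrow> 0"
      by (rule tendsto_sandwich[OF always_eventually always_eventually tendsto_const lim]) (use le in auto)
    have "Bochner_Integration.simple_bochner_integral M (\<lambda>\<omega>. s i \<omega> \<bullet> u) = Bochner_Integration.simple_bochner_integral M (s i) \<bullet> u" for i
      by (rule Bochner_Integration.simple_bochner_integral_linear[OF _ s])
        (simp add: bounded_linear.linear bounded_linear_inner_left)
    with x show "(\<lambda>i. Bochner_Integration.simple_bochner_integral M (\<lambda>\<omega>. s i \<omega> \<bullet> u)) \<longlonglongrightarrow> x \<bullet> u"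
      by (auto intro!: tendsto_intros)
  qed
  then have "has_bochner_integral M (\<lambda>\<omega>. norm y * (f \<omega> \<bullet> u)) (norm y * (x \<bullet> u))"
    by (intro has_bochner_integral_mult_right) auto
  moreover have "norm y * (v \<bullet> u) = v \<bullet> y" for v
    by (cases "y = 0") (simp_all add: u_def sgn_div_norm)
  ultimately show ?thesis
    by simp
qed

lemma has_bochner_expectation_unique:
  fixes f :: "'a \<Rightarrow> 'h::real_inner"
  assumes "has_bochner_expectation M f x" "has_bochner_expectation M f y"
  shows "x = y"
proof -
  have "x \<bullet> (x - y) = y \<bullet> (x - y)"
    using assms[THEN has_bochner_expectation_inner, of "x - y"] has_bochner_integral_eq by blast
  then show ?thesis
    by (metis eq_iff_diff_eq_0 inner_diff_left inner_eq_zero_iff)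
qed

lemma bochner_expectation_eqI:
  fixes f :: "'a \<Rightarrow> 'h::real_inner"
  shows "has_bochner_expectation M f x \<Longrightarrow> bochner_expectation M f = x"
  unfolding bochner_expectation_def by (blast intro: has_bochner_expectation_unique)

text \<open>Testing both expectations against \<open>x - y\<close> turns the claim into a real
  integral inequality, from which one factor \<open>norm (x - y)\<close> cancels.\<close>

lemma norm_has_bochner_expectation_diff_le:
  fixes f g :: "'a \<Rightarrow> 'h::real_inner"
  assumes f: "has_bochner_expectation M f x" and g: "has_bochner_expectation M g y"
    and h: "integrable M h" and le: "\<And>\<omega>. norm (f \<omega> - g \<omega>) \<le> h \<omega>"
  shows "norm (x - y) \<le> (\<integral>\<omega>. h \<omega> \<partial>M)"
proof (cases "x = y")
  case True
  have "0 \<le> h \<omega>" for \<omega>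
    using le[of \<omega>] norm_ge_zero order_trans by blast
  with True show ?thesis
    by simp
next
  case False
  have I: "has_bochner_integral M (\<lambda>\<omega>. (f \<omega> - g \<omega>) \<bullet> (x - y)) ((x - y) \<bullet> (x - y))"
    using has_bochner_integral_diff[OF has_bochner_expectation_inner[OF f, of "x - y"]
      has_bochner_expectation_inner[OF g, of "x - y"]]
    by (simp add: inner_diff_left)
  have "norm (x - y) * norm (x - y) = (\<integral>\<omega>. (f \<omega> - g \<omega>) \<bullet> (x - y) \<partial>M)"
    using has_bochner_integral_integral_eq[OF I] by (simp add: norm_eq_sqrt_inner)
  also have "\<dots> \<le> (\<integral>\<omega>. h \<omega> * norm (x - y) \<partial>M)"
  proof (rule integral_mono)
    show "integrable M (\<lambda>\<omega>. (f \<omega> - g \<omega>) \<bullet> (x - y))"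
      using I by (rule integrable.intros)
    show "(f \<omega> - g \<omega>) \<bullet> (x - y) \<le> h \<omega> * norm (x - y)" for \<omega>
      using norm_cauchy_schwarz[of "f \<omega> - g \<omega>" "x - y"] mult_right_mono[OF le[of \<omega>], of "norm (x - y)"]
      by simp
  qed (use h in simp)
  also have "\<dots> = (\<integral>\<omega>. h \<omega> \<partial>M) * norm (x - y)"
    by simp
  finally show ?thesis
    using False by simp
qed

lemma random_element_continuous:
  assumes X: "random_element M X" and g: "continuous_on UNIV g"
  shows "random_element M (\<lambda>\<omega>. g (X \<omega>))"
proof -
  obtain D where D: "countable D" "AE \<omega> in M. X \<omega> \<in> closure D" and X: "X \<in> borel_measurable M"
    using X unfolding random_element_def by blast
  have "g ` closure D \<subseteq> closure (g ` D)"
    by (rule image_closure_subset[OF continuous_on_subset[OF g] closed_closure closure_subset]) simp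
  then have "AE \<omega> in M. g (X \<omega>) \<in> closure (g ` D)"
    using D(2) by (auto elim!: eventually_mono)
  with D(1) borel_measurable_continuous_on[OF g X] show ?thesis
    unfolding random_element_def by blast
qed

section \<open>Clipping\<close>

definition clip :: "real \<Rightarrow> 'h::real_normed_vector \<Rightarrow> 'h" where
  "clip \<beta> v = psi_H \<beta> (norm v) *\<^sub>R (v /\<^sub>R norm v)"

definition excess :: "real \<Rightarrow> 'h::real_normed_vector \<Rightarrow> 'h" where
  "excess \<beta> v = v - clip \<beta> v"

lemma clip_eq: "clip \<beta> v = (if norm v \<le> \<beta> then v else (\<beta> / norm v) *\<^sub>R v)"
  by (cases "v = 0") (auto simp: clip_def psi_H_def divide_inverse)

lemma norm_clip_le: "\<beta> > 0 \<Longrightarrow> norm (clip \<beta> v) \<le> \<beta>"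
  by (auto simp: clip_eq)

lemma excess_eq_0: "norm v \<le> \<beta> \<Longrightarrow> excess \<beta> v = 0"
  by (simp add: excess_def clip_eq)

lemma excess_eq: "\<not> norm v \<le> \<beta> \<Longrightarrow> excess \<beta> v = (1 - \<beta> / norm v) *\<^sub>R v"
  by (simp add: excess_def clip_eq scaleR_diff_left)

lemma norm_excess:
  assumes "\<beta> > 0"
  shows "norm (excess \<beta> v) = max 0 (norm v - \<beta>)"
proof (cases "norm v \<le> \<beta>")
  case False
  then have "0 \<le> 1 - \<beta> / norm v"
    using assms False by (cases "v = 0") (auto simp: divide_le_eq)
  then have "norm (excess \<beta> v) = (1 - \<beta> / norm v) * norm v"
    by (simp only: excess_eq[OF False] norm_scaleR abs_of_nonneg)
  with False assms show ?thesis
    by (cases "v = 0") (auto simp: left_diff_distrib)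
qed (simp add: excess_eq_0)

text \<open>Outside the ball both vectors are positive multiples of \<open>v\<close> and
  \<open>clip \<beta> v\<close> has norm \<open>\<beta>\<close>, so this is the equality case of
  Cauchy-Schwarz.\<close>

lemma inner_clip_excess:
  fixes v :: "'h::real_inner"
  assumes "\<beta> > 0"
  shows "clip \<beta> v \<bullet> excess \<beta> v = \<beta> * norm (excess \<beta> v)"
proof (cases "norm v \<le> \<beta>")
  case False
  then have "norm v \<noteq> 0"
    using assms by auto
  have "clip \<beta> v \<bullet> excess \<beta> v = \<beta> / norm v * (1 - \<beta> / norm v) * (norm v)\<^sup>2"
    using False by (simp add: excess_eq clip_eq power2_norm_eq_inner)
  also have "\<dots> = \<beta> * (norm v - \<beta>)"
    using \<open>norm v \<noteq> 0\<close> by (simp add: field_simps power2_eq_square)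
  finally show ?thesis
    using False assms by (simp add: norm_excess)
qed (simp add: excess_eq_0)

text \<open>
  \<open>clip \<beta>\<close> is the nearest-point projection onto the ball of radius \<open>\<beta>\<close>, so it is firmly nonexpansive:
  \<open>u - v\<close> splits into the increments of \<open>clip\<close> and of \<open>excess\<close>, whose inner product is nonnegative.
\<close>

lemma norm_excess_diff_le:
  fixes u v :: "'h::real_inner"
  assumes "\<beta> > 0"
  shows "norm (excess \<beta> u - excess \<beta> v) \<le> norm (u - v)"
proof -
  \<comment> \<open>The variational inequality of the projection: \<open>excess \<beta> b\<close> is
    an outward normal to the ball at \<open>clip \<beta> b\<close>.\<close>
  have le: "clip \<beta> a \<bullet> excess \<beta> b \<le> clip \<beta> b \<bullet> excess \<beta> b" for a b :: 'h
  proof -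
    have "clip \<beta> a \<bullet> excess \<beta> b \<le> norm (clip \<beta> a) * norm (excess \<beta> b)"
      by (rule norm_cauchy_schwarz)
    also have "\<dots> \<le> \<beta> * norm (excess \<beta> b)"
      using norm_clip_le[OF assms] by (intro mult_right_mono) auto
    finally show ?thesis
      by (simp add: inner_clip_excess[OF assms])
  qed
  define c e where "c = clip \<beta> u - clip \<beta> v" and "e = excess \<beta> u - excess \<beta> v"
  have "0 \<le> c \<bullet> e"
    using le[of u v] le[of v u] by (simp add: c_def e_def inner_diff_left inner_diff_right)
  moreover have "u - v = e + c"
    by (simp add: c_def e_def excess_def)
  ultimately have "e \<bullet> e \<le> (u - v) \<bullet> (u - v)"
    using inner_ge_zero[of c] by (simp add: inner_add_left inner_add_right inner_commute[of e c])
  then show ?thesis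
    by (simp add: e_def norm_eq_sqrt_inner)
qed

lemma norm_excess_shift_diff_le:
  fixes x a b :: "'h::real_inner"
  assumes "\<beta> > 0"
  shows "norm (excess \<beta> (x - a) - excess \<beta> (x - b)) \<le> norm (a - b)"
proof -
  have "(x - a) - (x - b) = b - a"
    by simp
  then show ?thesis
    using norm_excess_diff_le[OF assms, of "x - a" "x - b"] by (simp only: norm_minus_commute[of a b])
qed

lemma continuous_on_excess:
  fixes \<theta> :: "'h::real_inner"
  assumes "\<beta> > 0"
  shows "continuous_on UNIV (\<lambda>x. excess \<beta> (x - \<theta>))"
proof (rule continuous_onI)
  fix x :: 'h and \<epsilon> :: real assume "\<epsilon> > 0"
  moreover have "dist (excess \<beta> (x' - \<theta>)) (excess \<beta> (x - \<theta>)) \<le> dist x' x" for x'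
    using norm_excess_diff_le[OF assms, of "x' - \<theta>" "x - \<theta>"] by (simp add: dist_norm)
  ultimately show "\<exists>d>0. \<forall>x'\<in>UNIV. dist x' x < d \<longrightarrow> dist (excess \<beta> (x' - \<theta>)) (excess \<beta> (x - \<theta>)) \<le> \<epsilon>"
    by (intro exI[of _ \<epsilon>]) (smt (verit))
qed

section \<open>The Huber loss\<close>

lemma rho_1_eq:
  assumes "x \<ge> 0"
  shows "rho_1 x = (if x \<le> 1 then x\<^sup>2 / 2 else x - 1 / 2)"
proof -
  have le1: "(psi_1 has_integral x\<^sup>2 / 2) {0..x}" if "0 \<le> x" "x \<le> 1" for x :: real
  proof -
    have "((\<lambda>x. x) has_integral x\<^sup>2 / 2 - 0\<^sup>2 / 2) {0..x}"
      using that by (intro fundamental_theorem_of_calculus)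
        (auto intro!: derivative_eq_intros simp flip: has_real_derivative_iff_has_vector_derivative)
    then show ?thesis
      using that by (subst has_integral_cong[where g = "\<lambda>x. x"]) (auto simp: psi_1_def)
  qed
  show ?thesis
  proof (cases "x \<le> 1")
    case True
    with le1[of x] assms show ?thesis
      by (simp add: rho_1_def integral_unique)
  next
    case False
    then have "((\<lambda>x. 1) has_integral x - 1) {1..x}"
      using has_integral_const_real[of "1::real" 1 x] by simp
    then have "(psi_1 has_integral x - 1) {1..x}"
      by (subst has_integral_cong[where g = "\<lambda>x. 1"]) (auto simp: psi_1_def)
    then have "(psi_1 has_integral (1 / 2 + (x - 1))) {0..x}"
      using le1[of 1] False by (intro has_integral_combine[of 0 1 x]) auto
    with False show ?thesis
      by (simp add: rho_1_def integral_unique)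
  qed
qed

lemma rho_1_nonneg: "x \<ge> 0 \<Longrightarrow> 0 \<le> rho_1 x"
  by (simp add: rho_1_eq)

lemma rho_1_le: "x \<ge> 0 \<Longrightarrow> rho_1 x \<le> x"
  using mult_right_mono[of x 1 x] by (auto simp: rho_1_eq power2_eq_square)

text \<open>The value 2/9 is four times \<open>rho_1 (1 / 3) = 1 / 18\<close>. With the smallness
  hypothesis, Markov's inequality then leaves mass at most 1/4 at distance at least
  \<open>2 * \<beta> / 3\<close> from the mean.\<close>

lemma rho_1_ge_two_thirds:
  assumes "x \<ge> 2 / 3"
  shows "2 / 9 \<le> rho_1 x"
  using assms power_mono[of "2 / 3" x 2] by (simp add: rho_1_eq power2_eq_square)

lemma excess_le_rho_1:
  assumes "x \<ge> 0"
  shows "max 0 (x - 1) \<le> rho_1 x"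
  using rho_1_nonneg[OF assms] by (cases "x \<le> 1") (simp_all add: rho_1_eq)

lemma continuous_on_rho_1: "continuous_on {0..} rho_1"
proof -
  have "rho_1 x = (min x 1)\<^sup>2 / 2 + max 0 (x - 1)" if "x \<ge> 0" for x
    using that by (auto simp: rho_1_eq min_def max_def)
  moreover have "continuous_on {0..} (\<lambda>x::real. (min x 1)\<^sup>2 / 2 + max 0 (x - 1))"
    by (intro continuous_intros) auto
  ultimately show ?thesis
    using continuous_on_cong by (metis (no_types, lifting) atLeast_iff)
qed

text \<open>By Bernoulli's inequality, \<open>t ^ q \<ge> 1 + q (t - 1) \<ge> (q - 1) (t - 1)\<close>.\<close>

lemma excess_le_power:
  fixes x \<beta> :: real
  assumes "\<beta> > 0" "q \<ge> 2" "x \<ge> 0"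
  shows "max 0 (x - \<beta>) \<le> x ^ q / ((real q - 1) * \<beta> ^ (q - 1))"
proof (cases "x \<le> \<beta>")
  case True
  then show ?thesis
    using assms by simp
next
  case False
  define t where "t = x / \<beta>"
  have "t \<ge> 1"
    using False assms by (simp add: t_def)
  then have "(real q - 1) * (t - 1) \<le> 1 + real q * (t - 1)"
    by (simp add: algebra_simps)
  also have "\<dots> \<le> t ^ q"
    using Bernoulli_inequality[of "t - 1" q] \<open>t \<ge> 1\<close> by simp
  finally have "(t - 1) * \<beta> \<le> t ^ q / (real q - 1) * \<beta>"
    using assms by (intro mult_right_mono) (auto simp: field_simps)
  also have "\<beta> ^ q = \<beta> * \<beta> ^ (q - 1)"
    using assms by (simp add: power_eq_if)
  then have "t ^ q / (real q - 1) * \<beta> = x ^ q / ((real q - 1) * \<beta> ^ (q - 1))"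
    using assms by (simp add: t_def power_divide)
  also have "(t - 1) * \<beta> = x - \<beta>"
    using assms by (simp add: t_def left_diff_distrib)
  finally show ?thesis
    using False by simp
qed

section \<open>Location of the Huber functional\<close>

text \<open>
  The mean is given weakly, because inner products transfer along \<open>distr\<close> with the library's real integral.
\<close>

locale huber_location = prob_space P
  for P :: "'h::{real_inner, complete_space} measure" +
  fixes m :: 'h and \<beta> :: real
  assumes sets_P: "sets P = sets borel"
    and rand: "random_element P (\<lambda>x. x)"
    and integrable_norm: "integrable P norm"
    and mean: "\<And>y. (\<integral>x. x \<bullet> y \<partial>P) = m \<bullet> y"
    and \<beta>: "\<beta> > 0"
    and small: "(\<integral>x. rho_1 (norm (x - m) / \<beta>) \<partial>P) \<le> rho_1 (1 / 3)"
begin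

text \<open>Linear growth suffices because the first moment is finite.\<close>

lemma integrable_continuous:
  fixes g :: "'h \<Rightarrow> real"
  assumes "continuous_on UNIV g" "\<And>x. \<bar>g x\<bar> \<le> a * norm x + b"
  shows "integrable P g"
proof (rule Bochner_Integration.integrable_bound)
  show "integrable P (\<lambda>x. a * norm x + b)"
    using integrable_norm by simp
  show "g \<in> borel_measurable P"
    using borel_measurable_continuous_onI[OF assms(1)] measurable_cong_sets[OF sets_P refl] by blast
  show "AE x in P. norm (g x) \<le> norm (a * norm x + b)"
    using assms(2) by (intro always_eventually) (metis abs_ge_self order_trans real_norm_def)
qed

abbreviation rho :: "'h \<Rightarrow> real" where
  "rho x \<equiv> rho_1 (norm (x - m) / \<beta>)"

lemma integrable_rho: "integrable P rho"
proof (rule integrable_continuous[where a = "1 / \<beta>" and b = "norm m / \<beta>"])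
  show "continuous_on UNIV rho"
    using \<beta> by (intro continuous_on_compose2[OF continuous_on_rho_1] continuous_intros) auto
  fix x
  have "rho x \<le> norm (x - m) / \<beta>"
    using \<beta> by (intro rho_1_le) simp
  also have "\<dots> \<le> 1 / \<beta> * norm x + norm m / \<beta>"
    using \<beta> norm_triangle_ineq4[of x m] by (simp add: field_simps)
  finally show "\<bar>rho x\<bar> \<le> 1 / \<beta> * norm x + norm m / \<beta>"
    using \<beta> rho_1_nonneg[of "norm (x - m) / \<beta>"] by simp
qed

lemma integral_rho_le: "(\<integral>x. rho x \<partial>P) \<le> 1 / 18"
  using small rho_1_eq[of "1 / 3"] by (simp add: power2_eq_square)

section \<open>The mean excess and the fixed-point equation\<close>

definition mean_excess :: "'h \<Rightarrow> 'h" where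
  "mean_excess \<theta> = bochner_expectation P (\<lambda>x. excess \<beta> (x - \<theta>))"

lemma has_bochner_expectation_mean_excess: "has_bochner_expectation P (\<lambda>x. excess \<beta> (x - \<theta>)) (mean_excess \<theta>)"
proof -
  have "\<bar>norm (excess \<beta> (x - \<theta>))\<bar> \<le> 1 * norm x + norm \<theta>" for x
    using \<beta> norm_triangle_ineq4[of x \<theta>] by (simp add: norm_excess)
  then have "integrable P (\<lambda>x. norm (excess \<beta> (x - \<theta>)))"
    by (intro integrable_continuous continuous_on_norm continuous_on_excess \<beta>)
  then have "\<exists>y. has_bochner_expectation P (\<lambda>x. excess \<beta> (x - \<theta>)) y"
    using random_element_continuous[OF rand continuous_on_excess[OF \<beta>]]
    by (intro has_bochner_expectation_exists)
  then obtain y where y: "has_bochner_expectation P (\<lambda>x. excess \<beta> (x - \<theta>)) y" ..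
  with bochner_expectation_eqI[OF y] show ?thesis
    by (simp add: mean_excess_def)
qed

lemma has_bochner_expectation_clip:
  "has_bochner_expectation P (\<lambda>x. clip \<beta> (x - \<theta>)) (m - \<theta> - mean_excess \<theta>)"
proof -
  have eq: "clip \<beta> (x - \<theta>) = (x - \<theta>) - excess \<beta> (x - \<theta>)" for x
    by (simp add: excess_def)
  have cont: "continuous_on UNIV (\<lambda>x. clip \<beta> (x - \<theta>))"
    unfolding eq by (intro continuous_intros continuous_on_excess \<beta>)
  have "integrable P (\<lambda>x. norm (clip \<beta> (x - \<theta>)))"
    using cont norm_clip_le[OF \<beta>]
    by (intro integrable_continuous[where a = 0 and b = \<beta>] continuous_on_norm) auto
  then obtain c where c: "has_bochner_expectation P (\<lambda>x. clip \<beta> (x - \<theta>)) c"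
    using random_element_continuous[OF rand cont] has_bochner_expectation_exists by blast
  \<comment> \<open>Boundedness of \<open>clip\<close> gave only the existence of \<open>c\<close>.
    Its value is found by testing against every \<open>y\<close>, since the mean \<open>m\<close> is
    known through inner products.\<close>
  have "c \<bullet> y = (m - \<theta> - mean_excess \<theta>) \<bullet> y" for y
  proof -
    have "has_bochner_integral P (\<lambda>x. excess \<beta> (x - \<theta>) \<bullet> y + clip \<beta> (x - \<theta>) \<bullet> y) (mean_excess \<theta> \<bullet> y + c \<bullet> y)"
      by (intro has_bochner_integral_add has_bochner_expectation_inner c has_bochner_expectation_mean_excess)
    moreover have "excess \<beta> (x - \<theta>) \<bullet> y + clip \<beta> (x - \<theta>) \<bullet> y = x \<bullet> y - \<theta> \<bullet> y" for x
      by (simp add: excess_def inner_diff_left)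
    ultimately have "(\<integral>x. x \<bullet> y - \<theta> \<bullet> y \<partial>P) = mean_excess \<theta> \<bullet> y + c \<bullet> y"
      by (metis (no_types, lifting) has_bochner_integral_integral_eq Bochner_Integration.integral_cong)
    moreover have "integrable P (\<lambda>x. x \<bullet> y)"
      by (rule integrable_continuous[where a = "norm y" and b = 0])
        (use Cauchy_Schwarz_ineq2[of _ y] in \<open>auto intro!: continuous_intros simp: mult.commute\<close>)
    ultimately show ?thesis
      using mean[of y] by (simp add: prob_space inner_diff_left)
  qed
  then have "c = m - \<theta> - mean_excess \<theta>"
    by (metis vector_eq_rdot)
  with c show ?thesis
    by simp
qed

lemma is_huber_location_iff: "is_huber_location \<beta> P \<theta> \<longleftrightarrow> \<theta> = m - mean_excess \<theta>"
proof -
  have "is_huber_location \<beta> P \<theta> \<longleftrightarrow> has_bochner_expectation P (\<lambda>x. clip \<beta> (x - \<theta>)) 0"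
    by (simp add: is_huber_location_def clip_def)
  also have "\<dots> \<longleftrightarrow> m - \<theta> - mean_excess \<theta> = 0"
    using has_bochner_expectation_clip has_bochner_expectation_unique by metis
  finally show ?thesis
    by (auto simp: algebra_simps)
qed

section \<open>Size of the mean excess, contraction and fixed points\<close>

lemma norm_mean_excess_m_le_integral: "norm (mean_excess m) \<le> (\<integral>x. max 0 (norm (x - m) - \<beta>) \<partial>P)"
  and integrable_max: "integrable P (\<lambda>x. max 0 (norm (x - m) - \<beta>))"
proof -
  have "\<bar>max 0 (norm (x - m) - \<beta>)\<bar> \<le> 1 * norm x + norm m" for x
    using \<beta> norm_triangle_ineq4[of x m] by simp
  then show int: "integrable P (\<lambda>x. max 0 (norm (x - m) - \<beta>))"
    by (intro integrable_continuous continuous_intros)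
  \<comment> \<open>Comparison with the zero function turns the bound on differences of expectations
    into a bound on \<open>norm (mean_excess m)\<close>.\<close>
  have "has_bochner_expectation P (\<lambda>x. 0) (0::'h)"
    unfolding has_bochner_expectation_def
    by (auto intro!: exI[of _ "\<lambda>_ _. 0"] simp: Bochner_Integration.simple_bochner_integrable.simps
      Bochner_Integration.simple_bochner_integral_def image_constant_conv)
  from norm_has_bochner_expectation_diff_le[OF has_bochner_expectation_mean_excess[of m] this int]
  show "norm (mean_excess m) \<le> (\<integral>x. max 0 (norm (x - m) - \<beta>) \<partial>P)"
    by (simp add: norm_excess[OF \<beta>])
qed

lemma norm_mean_excess_m_le: "norm (mean_excess m) \<le> \<beta> / 18"
proof -
  have "max 0 (norm (x - m) - \<beta>) \<le> \<beta> * rho x" for x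
    using mult_left_mono[OF excess_le_rho_1[of "norm (x - m) / \<beta>"], of \<beta>] \<beta>
    by (simp add: max_mult_distrib_left right_diff_distrib)
  then have "(\<integral>x. max 0 (norm (x - m) - \<beta>) \<partial>P) \<le> (\<integral>x. \<beta> * rho x \<partial>P)"
    using integrable_rho by (intro integral_mono integrable_max) auto
  also have "\<dots> = \<beta> * (\<integral>x. rho x \<partial>P)"
    by simp
  also have "\<dots> \<le> \<beta> * (1 / 18)"
    using \<beta> integral_rho_le by (intro mult_left_mono) auto
  finally show ?thesis
    using norm_mean_excess_m_le_integral by linarith
qed

text \<open>
  When \<open>norm (x - m) < 2 * \<beta> / 3\<close>, the point \<open>x\<close> is within \<open>\<beta>\<close> of both arguments and its excesses vanish;
  the other points have mass at most \<open>1 / 4\<close>, because \<open>rho_1 \<ge> 2 / 9\<close> there.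
\<close>

lemma mean_excess_contraction:
  assumes "dist m a \<le> \<beta> / 4" "dist m b \<le> \<beta> / 4"
  shows "norm (mean_excess a - mean_excess b) \<le> norm (a - b) / 4"
proof -
  have "norm (excess \<beta> (x - a) - excess \<beta> (x - b)) \<le> norm (a - b) * (9 / 2 * rho x)" for x
  proof (cases "norm (x - m) / \<beta> \<ge> 2 / 3")
    case True
    have "1 \<le> 9 / 2 * rho x"
      using rho_1_ge_two_thirds[OF True] by linarith
    from mult_left_mono[OF this norm_ge_zero[of "a - b"]] norm_excess_shift_diff_le[OF \<beta>, of x a b]
    show ?thesis
      by linarith
  next
    case False
    then have "norm (x - m) < 2 / 3 * \<beta>"
      using \<beta> by (simp add: field_simps)
    \<comment> \<open>The radii fit since 2/3 + 1/4 = 11/12 < 1.\<close>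
    then have "norm (x - c) \<le> \<beta>" if "dist m c \<le> \<beta> / 4" for c
      using that \<beta> norm_triangle_ineq[of "x - m" "m - c"] unfolding dist_norm by simp
    then show ?thesis
      using \<beta> assms by (simp add: excess_eq_0 rho_1_nonneg)
  qed
  then have "norm (mean_excess a - mean_excess b) \<le> (\<integral>x. norm (a - b) * (9 / 2 * rho x) \<partial>P)"
    using integrable_rho
    by (intro norm_has_bochner_expectation_diff_le[OF has_bochner_expectation_mean_excess
      has_bochner_expectation_mean_excess]) simp_all
  also have "\<dots> = norm (a - b) * (9 / 2 * (\<integral>x. rho x \<partial>P))"
    by simp
  also have "\<dots> \<le> norm (a - b) * (9 / 2 * (1 / 18))"
    using integral_rho_le by (intro mult_left_mono) auto
  finally show ?thesis
    by simp
qed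

text \<open>The ball of radius \<open>\<beta> / 4\<close> is mapped into itself: contraction moves
  the mean excess by at most \<open>\<beta> / 16\<close> from its value at \<open>m\<close>, which
  has norm at most \<open>\<beta> / 18\<close>, and 1/16 + 1/18 < 1/4.\<close>

lemma ex_mean_excess_fixpoint: "\<exists>\<theta>. dist m \<theta> \<le> \<beta> / 4 \<and> \<theta> = m - mean_excess \<theta>"
proof -
  have "\<exists>!\<theta>. \<theta> \<in> cball m (\<beta> / 4) \<and> m - mean_excess \<theta> = \<theta>"
  proof (rule Banach_fix[where c = "1 / 4"])
    show "uniform_space_class.complete (cball m (\<beta> / 4))"
      by (simp add: complete_eq_closed)
    show "cball m (\<beta> / 4) \<noteq> {}"
      using \<beta> by simp
    show "(\<lambda>\<theta>. m - mean_excess \<theta>) ` cball m (\<beta> / 4) \<subseteq> cball m (\<beta> / 4)"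
    proof (rule image_subsetI)
      fix \<theta> assume "\<theta> \<in> cball m (\<beta> / 4)"
      then have "dist m \<theta> \<le> \<beta> / 4"
        by simp
      then have "norm (mean_excess \<theta> - mean_excess m) \<le> \<beta> / 16"
        using mean_excess_contraction[of \<theta> m] \<beta> by (simp add: dist_norm norm_minus_commute[of \<theta> m])
      then show "m - mean_excess \<theta> \<in> cball m (\<beta> / 4)"
        using norm_triangle_sub[of "mean_excess \<theta>" "mean_excess m"] norm_mean_excess_m_le \<beta> by (simp add: dist_norm)
    qed
    show "dist (m - mean_excess a) (m - mean_excess b) \<le> 1 / 4 * dist a b"
      if "a \<in> cball m (\<beta> / 4)" "b \<in> cball m (\<beta> / 4)" for a b
    proof -
      have "dist (m - mean_excess a) (m - mean_excess b) = norm (mean_excess b - mean_excess a)"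
        by (simp add: dist_norm)
      then show ?thesis
        using that mean_excess_contraction[of b a] by (simp add: dist_norm norm_minus_commute[of a b])
    qed
  qed auto
  then show ?thesis
    by (metis mem_cball)
qed

lemma mean_excess_strict_nonexpansive:
  assumes a: "dist m a \<le> \<beta> / 4" and "a \<noteq> b"
  shows "norm (mean_excess a - mean_excess b) < norm (a - b)"
proof -
  \<comment> \<open>The slack is \<open>\<beta> / 12\<close> because
    \<open>norm (x - a) \<le> 11 / 12 * \<beta>\<close> for \<open>x\<close> near \<open>m\<close>.
    The minimum keeps \<open>norm (a - b) - \<delta>\<close> nonnegative, as needed when the excess
    at \<open>b\<close> vanishes.\<close>
  define \<delta> where "\<delta> = min (norm (a - b)) (\<beta> / 12)"
  have \<delta>: "\<delta> > 0"
    using \<open>a \<noteq> b\<close> \<beta> by (simp add: \<delta>_def)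
  \<comment> \<open>The factor \<open>1 - 9 / 2 * rho x\<close> is a lower bound for the indicator
    of the points near \<open>m\<close>, and its integral is at least 3/4.\<close>
  have "norm (excess \<beta> (x - a) - excess \<beta> (x - b)) \<le> norm (a - b) - \<delta> * (1 - 9 / 2 * rho x)" for x
  proof (cases "norm (x - m) / \<beta> \<ge> 2 / 3")
    case True
    have "1 - 9 / 2 * rho x \<le> 0"
      using rho_1_ge_two_thirds[OF True] by linarith
    from mult_nonneg_nonpos[OF less_imp_le[OF \<delta>] this] norm_excess_shift_diff_le[OF \<beta>, of x a b]
    show ?thesis
      by linarith
  next
    case False
    then have "norm (x - m) < 2 / 3 * \<beta>"
      using \<beta> by (simp add: field_simps)
    then have xa: "norm (x - a) \<le> 11 / 12 * \<beta>"
      using a norm_triangle_ineq[of "x - m" "m - a"] by (simp add: dist_norm)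
    then have "norm (excess \<beta> (x - a) - excess \<beta> (x - b)) = max 0 (norm (x - b) - \<beta>)"
      using \<beta> by (simp add: excess_eq_0 norm_excess)
    also have "\<dots> \<le> norm (a - b) - \<delta>"
      using xa norm_triangle_ineq[of "x - a" "a - b"] by (simp add: \<delta>_def)
    also have "\<dots> \<le> norm (a - b) - \<delta> * (1 - 9 / 2 * rho x)"
      using \<delta> \<beta> rho_1_nonneg[of "norm (x - m) / \<beta>"] by (simp add: right_diff_distrib)
    finally show ?thesis .
  qed
  then have "norm (mean_excess a - mean_excess b) \<le> (\<integral>x. norm (a - b) - \<delta> * (1 - 9 / 2 * rho x) \<partial>P)"
    using integrable_rho
    by (intro norm_has_bochner_expectation_diff_le[OF has_bochner_expectation_mean_excess
      has_bochner_expectation_mean_excess]) simp_all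
  also have "\<dots> = norm (a - b) - \<delta> * (1 - 9 / 2 * (\<integral>x. rho x \<partial>P))"
    using integrable_rho by (simp add: prob_space)
  also have "\<dots> < norm (a - b)"
    using \<delta> integral_rho_le by simp
  finally show ?thesis .
qed

theorem norm_diff_T_H_le: "norm (m - T_H \<beta> P) \<le> 2 * (\<integral>x. max 0 (norm (x - m) - \<beta>) \<partial>P)"
proof -
  obtain \<theta> where \<theta>: "dist m \<theta> \<le> \<beta> / 4" "\<theta> = m - mean_excess \<theta>"
    using ex_mean_excess_fixpoint by blast
  have T: "T_H \<beta> P = \<theta>"
    unfolding T_H_def
  proof (rule the_equality)
    show "is_huber_location \<beta> P \<theta>"
      using \<theta>(2) is_huber_location_iff by blast
    fix b assume "is_huber_location \<beta> P b"
    then have "b = m - mean_excess b"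
      using is_huber_location_iff by blast
    then have "\<theta> - b = (m - mean_excess \<theta>) - (m - mean_excess b)"
      using \<theta>(2) by simp
    then have "norm (\<theta> - b) = norm (mean_excess \<theta> - mean_excess b)"
      by (simp add: norm_minus_commute[of "mean_excess b"])
    then show "b = \<theta>"
      using mean_excess_strict_nonexpansive[OF \<theta>(1)] by force
  qed
  have "norm (m - \<theta>) = norm (mean_excess \<theta>)"
    using \<theta>(2) by (metis diff_eq_eq add_diff_cancel_left')
  \<comment> \<open>Absorbing this quarter on the left gives the factor 4/3, which is relaxed to
    2.\<close>
  moreover have "norm (mean_excess \<theta> - mean_excess m) \<le> norm (m - \<theta>) / 4"
    using mean_excess_contraction[OF \<theta>(1), of m] \<beta> by (simp add: norm_minus_commute[of \<theta> m])
  ultimately show ?thesis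
    unfolding T
    using norm_triangle_sub[of "mean_excess \<theta>" "mean_excess m"] norm_mean_excess_m_le_integral
      norm_ge_zero[of "m - \<theta>"]
    by linarith
qed

end

section \<open>Transfer from the law to the random variable, and the moment bound\<close>

theorem lemma4:
  fixes M :: "'a measure"
    and X :: "'a \<Rightarrow> 'h::{real_inner, complete_space}"
    and P :: "'h measure"
    and \<beta> :: real
    and q :: nat
  assumes "prob_space M"
    and "random_element M X"
    and "P = distr M borel X"
    and "\<beta> > 0"
    and "q \<ge> 2"
    and "integrable M (\<lambda>\<omega>. norm (X \<omega>) ^ q)"
    and "rho_1 (1 / 3) \<ge> (\<integral>\<omega>. rho_1 (norm (X \<omega> - bochner_expectation M X) / \<beta>) \<partial>M)"
  shows "norm (bochner_expectation M X - T_H \<beta> P)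
           \<le> 2 * (\<integral>\<omega>. norm (X \<omega> - bochner_expectation M X) ^ q \<partial>M) / ((real q - 1) * \<beta> ^ (q - 1))"
proof -
  interpret M: prob_space M by fact
  define m where "m = bochner_expectation M X"
  obtain D where X[measurable]: "X \<in> borel_measurable M" and D: "countable D" "AE \<omega> in M. X \<omega> \<in> closure D"
    using assms(2) unfolding random_element_def by blast
  have meas: "(\<lambda>\<omega>. g (X \<omega>)) \<in> borel_measurable M" if "continuous_on UNIV g" for g :: "'h \<Rightarrow> real"
    by (rule borel_measurable_continuous_on[OF that X])
  have borel: "g \<in> borel_measurable borel" if "continuous_on UNIV g" for g :: "'h \<Rightarrow> real"
    using that by (rule borel_measurable_continuous_onI)
  have int_X: "integrable M (\<lambda>\<omega>. norm (X \<omega>))"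
  proof (rule Bochner_Integration.integrable_bound)
    show "integrable M (\<lambda>\<omega>. 1 + norm (X \<omega>) ^ q)"
      using assms(6) by simp
    have "t \<le> 1 + t ^ q" if "t \<ge> 0" for t :: real
    proof (cases "t \<le> 1")
      case True
      then show ?thesis
        using add_mono[OF True zero_le_power[OF that]] by simp
    next
      case False
      then have "t \<le> t ^ q"
        using assms(5) by (intro self_le_power) auto
      then show ?thesis
        by simp
    qed
    then show "AE \<omega> in M. norm (norm (X \<omega>)) \<le> norm (1 + norm (X \<omega>) ^ q)"
      by (auto intro!: always_eventually)
  qed (auto intro: meas continuous_intros)
  obtain y where y: "has_bochner_expectation M X y"
    using has_bochner_expectation_exists[OF assms(2) int_X] ..
  then have "has_bochner_expectation M X m"
    using bochner_expectation_eqI[OF y] by (simp add: m_def)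
  then have mean: "(\<integral>\<omega>. X \<omega> \<bullet> y \<partial>M) = m \<bullet> y" for y
    by (intro has_bochner_integral_integral_eq has_bochner_expectation_inner)
  interpret huber_location P m \<beta>
  proof (intro huber_location.intro huber_location_axioms.intro)
    show "prob_space P"
      unfolding assms(3) by (rule M.prob_space_distr[OF X])
    show "random_element P (\<lambda>x. x)"
      unfolding random_element_def assms(3)
      using D by (auto intro!: exI[of _ D] simp: AE_distr_iff)
    show "integrable P norm"
      unfolding assms(3) using int_X by (subst integrable_distr_eq) (auto intro!: borel continuous_intros)
    show "(\<integral>x. x \<bullet> y \<partial>P) = m \<bullet> y" for y
      unfolding assms(3) by (subst integral_distr) (auto intro!: borel continuous_intros simp: mean)
    have "continuous_on UNIV (\<lambda>x. rho_1 (norm (x - m) / \<beta>))"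
      using assms(4) by (intro continuous_on_compose2[OF continuous_on_rho_1] continuous_intros) auto
    then show "(\<integral>x. rho_1 (norm (x - m) / \<beta>) \<partial>P) \<le> rho_1 (1 / 3)"
      unfolding assms(3) using assms(7) by (subst integral_distr) (auto simp: m_def intro!: borel)
  qed (use assms in auto)
  \<comment> \<open>Monotonicity of the integral needs this: a nonintegrable central moment would
    have the default value 0.\<close>
  have int_q: "integrable M (\<lambda>\<omega>. norm (X \<omega> - m) ^ q)"
  proof (rule Bochner_Integration.integrable_bound)
    show "integrable M (\<lambda>\<omega>. 2 ^ q * (norm (X \<omega>) ^ q + norm m ^ q))"
      using assms(6) by simp
    show "(\<lambda>\<omega>. norm (X \<omega> - m) ^ q) \<in> borel_measurable M"
      by (intro meas continuous_intros)
    have "norm (x - m) ^ q \<le> 2 ^ q * (norm x ^ q + norm m ^ q)" for x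
    proof -
      have "norm (x - m) ^ q \<le> (2 * max (norm x) (norm m)) ^ q"
        using norm_triangle_ineq4[of x m] by (intro power_mono) auto
      also have "\<dots> \<le> 2 ^ q * (norm x ^ q + norm m ^ q)"
        by (auto simp: power_mult_distrib max_def)
      finally show ?thesis .
    qed
    then show "AE \<omega> in M. norm (norm (X \<omega> - m) ^ q) \<le> norm (2 ^ q * (norm (X \<omega>) ^ q + norm m ^ q))"
      by (auto intro!: always_eventually)
  qed
  define K where "K = (real q - 1) * \<beta> ^ (q - 1)"
  have cont: "continuous_on UNIV (\<lambda>x. max 0 (norm (x - m) - \<beta>))"
    by (intro continuous_intros)
  have "(\<integral>x. max 0 (norm (x - m) - \<beta>) \<partial>P) = (\<integral>\<omega>. max 0 (norm (X \<omega> - m) - \<beta>) \<partial>M)"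
    unfolding assms(3) by (rule integral_distr[OF X borel[OF cont]])
  also have "\<dots> \<le> (\<integral>\<omega>. norm (X \<omega> - m) ^ q / K \<partial>M)"
  proof (rule integral_mono)
    show "integrable M (\<lambda>\<omega>. max 0 (norm (X \<omega> - m) - \<beta>))"
      using integrable_max integrable_distr_eq[OF X borel[OF cont]] assms(3) by simp
  qed (use int_q excess_le_power[OF assms(4,5)] in \<open>auto simp: K_def\<close>)
  also have "\<dots> = (\<integral>\<omega>. norm (X \<omega> - m) ^ q \<partial>M) / K"
    by simp
  finally show ?thesis
    using norm_diff_T_H_le unfolding m_def[symmetric] K_def[symmetric] by simp
qed

end
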